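(* Let $(X,\tau,\mathscr M,m)$ be a topological measure space. Then every locally Lipschitz function $f:X\to\mathbb K$ (where $\mathbb K$ is $\mathbb R$ or $\mathbb C$) is absolutely continuous.
   Context: Let $(X,\tau)$ be a topological space and $(X,\mathscr M,m)$ a measure space. $(X,\tau,\mathscr M,m)$ is called a topological measure space (tms) if: (i) $\mathscr M$ contains all open sets of $(X,\tau)$; (ii) for every $x\in X$ and every $\varepsilon>0$ there exists an open connected neighbourhood $U$ of $x$ with $m(U)<\varepsilon$; (iii) for every $G\in\tau$ and every $x\in G$ there exists $\varepsilon>0$ such that every open connected neighbourhood $U$ of $x$ with $m(U)<\varepsilon$ satisfies $U\subseteq G$. A function $f:X\to\mathbb K$ is locally Lipschitz (in the sense of this paper) if there exists $L>0$ such that for every open connected set $E\subseteq X$, $|f(x)-f(y)|\le L\cdot m(E)$ for all $x,y\in E$. For $\delta>0$, $\mathcal P_\delta$ denotes the collection of all countable (finite or infinite) families $\{E_i\}_i$ of pairwise disjoint open connected subsets of $X$ with $\sum_i m(E_i)<\delta$. A function $f:X\to\mathbb K$ is absolutely continuous if for every $\varepsilon>0$ there exists $\delta>0$ such that for every $\{D_i\}_i\in\mathcal P_\delta$ one has $\sum_i\omega(f,D_i)<\varepsilon$, where $\omega(f,D):=\sup\{|f(x)-f(y)|:x,y\in D\}$. *)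

theory Defs
  imports "HOL-Analysis.Analysis"
begin

locale topological_measure_space =
  fixes T :: "'a topology" and M :: "'a measure"
  assumes space_eq: "space M = topspace T"
    and open_measurable: "\<And>U. openin T U \<Longrightarrow> U \<in> sets M"
    and small_connected_nhd: "\<And>x \<epsilon>::real. x \<in> topspace T \<Longrightarrow> \<epsilon> > 0 \<Longrightarrow>
      \<exists>U. openin T U \<and> connectedin T U \<and> x \<in> U \<and> emeasure M U < ennreal \<epsilon>"
    and small_nhd_subset: "\<And>G x. openin T G \<Longrightarrow> x \<in> G \<Longrightarrow>
      \<exists>\<epsilon>::real. \<epsilon> > 0 \<and> (\<forall>U. openin T U \<and> connectedin T U \<and> x \<in> U \<and> emeasure M U < ennreal \<epsilon>
        \<longrightarrow> U \<subseteq> G)"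

text \<open>
  The constant is global and the bound is by the measure of the connected open set, which may be
  infinite; no metric on the domain is involved, unlike in \<^const>\<open>local_lipschitz\<close>.
\<close>

definition tms_locally_Lipschitz ::
  "'a topology \<Rightarrow> 'a measure \<Rightarrow> ('a \<Rightarrow> 'k::real_normed_field) \<Rightarrow> bool" where
  "tms_locally_Lipschitz T M f \<longleftrightarrow>
    (\<exists>L::real. L > 0 \<and> (\<forall>E. openin T E \<and> connectedin T E \<longrightarrow>
      (\<forall>x\<in>E. \<forall>y\<in>E. ennreal (norm (f x - f y)) \<le> ennreal L * emeasure M E)))"

text \<open>
  A countable family, finite or infinite, is a function on an index set \<open>I\<close> of natural numbers.
  The sums below are taken in \<^typ>\<open>ennreal\<close>, so they always exist.
\<close>

definition small_open_connected_family ::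
  "'a topology \<Rightarrow> 'a measure \<Rightarrow> real \<Rightarrow> nat set \<Rightarrow> (nat \<Rightarrow> 'a set) \<Rightarrow> bool" where
  "small_open_connected_family T M \<delta> I E \<longleftrightarrow>
    (\<forall>i\<in>I. openin T (E i) \<and> connectedin T (E i)) \<and>
    disjoint_family_on E I \<and>
    (\<Sum>\<^sub>\<infinity>i\<in>I. emeasure M (E i)) < ennreal \<delta>"

text \<open>The oscillation may be infinite, and it is \<open>0\<close> on the empty set.\<close>

definition oscillation :: "('a \<Rightarrow> 'k::real_normed_field) \<Rightarrow> 'a set \<Rightarrow> ennreal" where
  "oscillation f D = (SUP (x, y)\<in>D \<times> D. ennreal (norm (f x - f y)))"

text \<open>Not to be confused with \<^const>\<open>absolutely_continuous\<close>, which relates two measures.\<close>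

definition tms_absolutely_continuous ::
  "'a topology \<Rightarrow> 'a measure \<Rightarrow> ('a \<Rightarrow> 'k::real_normed_field) \<Rightarrow> bool" where
  "tms_absolutely_continuous T M f \<longleftrightarrow>
    (\<forall>\<epsilon>::real. \<epsilon> > 0 \<longrightarrow> (\<exists>\<delta>::real. \<delta> > 0 \<and>
      (\<forall>I D. small_open_connected_family T M \<delta> I D \<longrightarrow>
        (\<Sum>\<^sub>\<infinity>i\<in>I. oscillation f (D i)) < ennreal \<epsilon>)))"

end

theory Submission
  imports Defs
begin

text \<open>
  Taking the supremum over pairs of points turns the Lipschitz estimate into
  \<open>oscillation f D \<le> L * m(D)\<close> for open connected \<open>D\<close>. Summed over a family of total
  measure below \<open>\<delta>\<close>, this gives total oscillation below \<open>L * \<delta>\<close>, so \<open>\<delta> = \<epsilon> / L\<close> works.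
\<close>

text \<open>
  Multiplication by \<open>\<infinity>\<close> is not continuous at \<open>0\<close>, so the limit rules for products do not give
  this. It holds because a sum of nonnegative terms is the supremum of its finite partial sums,
  and multiplication by any constant commutes with suprema.
\<close>

lemma infsum_cmult_right_ennreal:
  fixes c :: ennreal
  shows "(\<Sum>\<^sub>\<infinity>i\<in>I. c * g i) = c * (\<Sum>\<^sub>\<infinity>i\<in>I. g i)"
proof -
  have "(\<Sum>\<^sub>\<infinity>i\<in>I. c * g i) = (SUP F\<in>{F. finite F \<and> F \<subseteq> I}. \<Sum>i\<in>F. c * g i)"
    by (rule nonneg_infsum_complete) simp
  also have "\<dots> = (SUP F\<in>{F. finite F \<and> F \<subseteq> I}. c * sum g F)"
    by (simp only: sum_distrib_left)
  also have "\<dots> = c * (SUP F\<in>{F. finite F \<and> F \<subseteq> I}. sum g F)"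
    by (rule SUP_mult_left_ennreal[symmetric])
  also have "(SUP F\<in>{F. finite F \<and> F \<subseteq> I}. sum g F) = (\<Sum>\<^sub>\<infinity>i\<in>I. g i)"
    by (rule nonneg_infsum_complete[symmetric]) simp
  finally show ?thesis .
qed

lemma tms_locally_Lipschitz_imp_absolutely_continuous:
  fixes f :: "'a \<Rightarrow> 'k::real_normed_field"
  assumes "tms_locally_Lipschitz T M f"
  shows "tms_absolutely_continuous T M f"
  unfolding tms_absolutely_continuous_def
proof (intro allI impI)
  fix \<epsilon> :: real
  assume "\<epsilon> > 0"
  obtain L :: real where "L > 0"
    and lip: "\<forall>E. openin T E \<and> connectedin T E \<longrightarrow>
      (\<forall>x\<in>E. \<forall>y\<in>E. ennreal (norm (f x - f y)) \<le> ennreal L * emeasure M E)"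
    using assms unfolding tms_locally_Lipschitz_def by (elim exE conjE)
  have osc: "oscillation f E \<le> ennreal L * emeasure M E"
    if "openin T E" "connectedin T E" for E
    unfolding oscillation_def
  proof (rule SUP_least, clarify)
    fix x y
    assume "x \<in> E" "y \<in> E"
    then show "ennreal (norm (f x - f y)) \<le> ennreal L * emeasure M E"
      using lip that by simp
  qed
  have "(\<Sum>\<^sub>\<infinity>i\<in>I. oscillation f (D i)) < ennreal \<epsilon>"
    if D: "small_open_connected_family T M (\<epsilon> / L) I D" for I D
  proof -
    have "openin T (D i)" "connectedin T (D i)" if "i \<in> I" for i
      using D that unfolding small_open_connected_family_def by blast+
    then have "(\<Sum>\<^sub>\<infinity>i\<in>I. oscillation f (D i)) \<le> (\<Sum>\<^sub>\<infinity>i\<in>I. ennreal L * emeasure M (D i))"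
      by (intro infsum_mono nonneg_summable_on_complete osc zero_le)
    also have "\<dots> = ennreal L * (\<Sum>\<^sub>\<infinity>i\<in>I. emeasure M (D i))"
      by (rule infsum_cmult_right_ennreal)
    also have "\<dots> < ennreal L * ennreal (\<epsilon> / L)"
    proof (rule ennreal_mult_strict_left_mono)
      show "(\<Sum>\<^sub>\<infinity>i\<in>I. emeasure M (D i)) < ennreal (\<epsilon> / L)"
        using D unfolding small_open_connected_family_def by blast
    qed (use \<open>L > 0\<close> in simp_all)
    also have "\<dots> = ennreal \<epsilon>"
      using \<open>L > 0\<close> \<open>\<epsilon> > 0\<close> by (subst ennreal_mult[symmetric]) auto
    finally show ?thesis .
  qed
  then show "\<exists>\<delta>::real. \<delta> > 0 \<and> (\<forall>I D. small_open_connected_family T M \<delta> I D \<longrightarrow>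
      (\<Sum>\<^sub>\<infinity>i\<in>I. oscillation f (D i)) < ennreal \<epsilon>)"
    using \<open>L > 0\<close> \<open>\<epsilon> > 0\<close> by (intro exI[of _ "\<epsilon> / L"]) simp
qed

theorem theorem5p5:
  fixes T :: "'a topology" and M :: "'a measure"
  assumes "topological_measure_space T M"
  shows "(\<forall>f :: 'a \<Rightarrow> real. tms_locally_Lipschitz T M f \<longrightarrow> tms_absolutely_continuous T M f) \<and>
         (\<forall>f :: 'a \<Rightarrow> complex. tms_locally_Lipschitz T M f \<longrightarrow> tms_absolutely_continuous T M f)"
  by (simp add: tms_locally_Lipschitz_imp_absolutely_continuous)

end
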